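(* For all $\alpha,\beta\in\vartheta(\varepsilon_{\Omega+1})$, if $f(\alpha)\trianglelefteq f(\beta)$ holds in $T_2$, then $\alpha\preceq\beta$.
   Context: Terms $\vartheta(\varepsilon_{\Omega+1})$, relation $\prec$ and finite sets $E(\alpha)$ are defined by simultaneous recursion (on term length $l$, where $l(\Omega)=0$, $l(\vartheta\alpha)=l(\alpha)+1$, $l(\langle\alpha_0,\dots,\alpha_{n-1}\rangle)=n+\sum_i l(\alpha_i)$): Terms: $\Omega$; $\vartheta\alpha$ for every term $\alpha$; $\langle\alpha_0,\dots,\alpha_{n-1}\rangle$ ($n\ge0$) for terms $\alpha_i$, provided that if $n>1$ then $\alpha_{n-1}\preceq\dots\preceq\alpha_0$ ($\preceq$ meaning $\prec$ or syntactic equality), and if $n=1$ then $\alpha_0$ is not of the form $\Omega$ or $\vartheta\beta$. $E(\Omega)=\emptyset$, $E(\vartheta\alpha)=\{\vartheta\alpha\}$, $E(\langle\alpha_0,\dots,\alpha_{n-1}\rangle)=\bigcup_{i<n}E(\alpha_i)$. $\alpha\prec\beta$ holds iff: (1) $\alpha=\Omega$ and $\beta=\langle\beta_0,\dots,\beta_{n-1}\rangle$ with $n>0$, $\Omega\preceq\beta_0$; or (2) $\alpha=\vartheta\alpha'$ and one of: $\beta=\Omega$; $\beta=\langle\beta_0,\dots,\beta_{n-1}\rangle$ with $n>0$, $\alpha\preceq\beta_0$; $\beta=\vartheta\beta'$ with $\alpha'\prec\beta'$ and $\gamma\prec\beta$ for all $\gamma\in E(\alpha')$; $\beta=\vartheta\beta'$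 with $\alpha\preceq\gamma$ for some $\gamma\in E(\beta')$; or (3) $\alpha=\langle\alpha_0,\dots,\alpha_{m-1}\rangle$ and one of: $\beta$ is $\Omega$ or some $\vartheta\beta'$, and $m=0$ or $\alpha_0\prec\beta$; $\beta=\langle\beta_0,\dots,\beta_{n-1}\rangle$ and for some $j\le\min(m,n)$, $\alpha_i=\beta_i$ for all $i<j$ and either $j=m<n$ or ($j<\min(m,n)$ and $\alpha_j\prec\beta_j$). $T_2$ is generated by: for a finite multiset $\sigma=[t_0,\dots,t_{k-1}]$ ($k\ge0$) of already constructed elements and $n\in\{0,1\}$, $n\star\sigma\in T_2$; $r(n\star\sigma)=n$. For a relation $\le$, $[x_0,\dots,x_{k-1}]\le^M[y_0,\dots,y_{m-1}]$ iff there is an injection $g$ with $x_i\le y_{g(i)}$ for all $i<k$. Recursively, $s\trianglelefteq t$ iff $s=m\star\sigma$, $t=n\star\tau$ with $m=n$ and $\sigma\trianglelefteq^M\tau$, or $t=n\star[t_0,\dots,t_{k-1}]$ with $r(s)\le n$ and $s\trianglelefteq t_i$ for some $i<k$. The map $f:\vartheta(\varepsilon_{\Omega+1})\to T_2$ is defined by $f(\Omega)=1\star[]$, $f(\vartheta\alpha)=0\star[1\star[f(\alpha)]]$, and $f(\langle\alpha_0,\dots,\alpha_{n-1}\rangle)=i\star[f(\alpha_0),\dots,f(\alpha_{n-1})]$ where $i=0$ if $n=0$ or $\alpha_0\prec\Omega$, and $i=1$ otherwise. *)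

theory Defs
  imports Main "HOL-Library.Multiset"
begin

text \<open>
  The terms are carved out of a datatype of raw terms. The recursion clauses for \<open>\<prec>\<close> and \<open>E\<close>
  only ever refer to subterms of their arguments, so the order on all raw terms restricts, on the set
  of (well-formed) terms, to the one obtained by simultaneous recursion.
\<close>

datatype rawterm = Omega | Theta rawterm | Seq "rawterm list"

fun len :: "rawterm \<Rightarrow> nat" where
  "len Omega = 0"
| "len (Theta a) = len a + 1"
| "len (Seq as) = length as + (\<Sum>a\<leftarrow>as. len a)"

fun E :: "rawterm \<Rightarrow> rawterm set" where
  "E Omega = {}"
| "E (Theta a) = {Theta a}"
| "E (Seq as) = (\<Union>a\<in>set as. E a)"

lemma finite_E: "finite (E a)"
  by (induction a) auto

lemma len_E: "c \<in> E a \<Longrightarrow> len c \<le> len a"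
proof (induction a)
  case (Seq as)
  then obtain a where a: "a \<in> set as" "c \<in> E a" by auto
  then have "len c \<le> len a" using Seq.IH by blast
  also have "len a \<le> (\<Sum>a\<leftarrow>as. len a)"
    using a(1) by (intro member_le_sum_list) auto
  finally show ?case by simp
qed auto

lemma len_nth: "i < length as \<Longrightarrow> len (as ! i) < len (Seq as)"
proof -
  assume i: "i < length as"
  have "len (as ! i) \<le> (\<Sum>a\<leftarrow>as. len a)"
    using i by (intro member_le_sum_list) auto
  with i show ?thesis by simp
qed

context
  notes conj_cong [fundef_cong] disj_cong [fundef_cong]
begin

function prec :: "rawterm \<Rightarrow> rawterm \<Rightarrow> bool"  (infix "\<prec>" 50) where
  "Omega \<prec> Omega \<longleftrightarrow> False"
| "Omega \<prec> Theta b \<longleftrightarrow> False"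
| "Omega \<prec> Seq bs \<longleftrightarrow> length bs > 0 \<and> (Omega \<prec> bs ! 0 \<or> Omega = bs ! 0)"
| "Theta a \<prec> Omega \<longleftrightarrow> True"
| "Theta a \<prec> Seq bs \<longleftrightarrow> length bs > 0 \<and> (Theta a \<prec> bs ! 0 \<or> Theta a = bs ! 0)"
| "Theta a \<prec> Theta b \<longleftrightarrow>
     (a \<prec> b \<and> (\<forall>c\<in>E a. c \<prec> Theta b)) \<or>
     (\<exists>c\<in>E b. Theta a \<prec> c \<or> Theta a = c)"
| "Seq as \<prec> Omega \<longleftrightarrow> length as = 0 \<or> as ! 0 \<prec> Omega"
| "Seq as \<prec> Theta b \<longleftrightarrow> length as = 0 \<or> as ! 0 \<prec> Theta b"
| "Seq as \<prec> Seq bs \<longleftrightarrow>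
     (\<exists>j\<le>min (length as) (length bs). (\<forall>i<j. as ! i = bs ! i) \<and>
        ((j = length as \<and> length as < length bs) \<or>
         (j < min (length as) (length bs) \<and> as ! j \<prec> bs ! j)))"
  by pat_completeness auto
termination
  by (relation "measure (\<lambda>(a, b). len a + len b)")
     (simp_all del: len.simps(3) add: len_nth add_strict_mono le_imp_less_Suc len_E)

end

abbreviation preceq :: "rawterm \<Rightarrow> rawterm \<Rightarrow> bool"  (infix "\<preceq>" 50) where
  "a \<preceq> b \<equiv> a \<prec> b \<or> a = b"

text \<open>The term system \<open>\<vartheta>(\<epsilon>\<^bsub>\<Omega>+1\<^esub>)\<close>.\<close>

inductive_set theta_terms :: "rawterm set" where
  Omega: "Omega \<in> theta_terms"
| Theta: "a \<in> theta_terms \<Longrightarrow> Theta a \<in> theta_terms"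
| Seq: "(\<forall>a\<in>set as. a \<in> theta_terms) \<Longrightarrow>
        (length as > 1 \<longrightarrow> (\<forall>i. Suc i < length as \<longrightarrow> as ! Suc i \<preceq> as ! i)) \<Longrightarrow>
        (length as = 1 \<longrightarrow> as ! 0 \<noteq> Omega \<and> (\<forall>b. as ! 0 \<noteq> Theta b)) \<Longrightarrow>
        Seq as \<in> theta_terms"

datatype tree = Star (root: nat) "tree multiset"  (infix "\<star>" 60)

inductive_set T2 :: "tree set" where
  "n \<in> {0, 1} \<Longrightarrow> (\<forall>t\<in>set_mset \<sigma>. t \<in> T2) \<Longrightarrow> n \<star> \<sigma> \<in> T2"

definition mset_le :: "('a \<Rightarrow> 'a \<Rightarrow> bool) \<Rightarrow> 'a multiset \<Rightarrow> 'a multiset \<Rightarrow> bool" where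
  "mset_le R M N \<longleftrightarrow> (\<exists>xs ys g. M = mset xs \<and> N = mset ys \<and>
     inj_on g {..<length xs} \<and> g ` {..<length xs} \<subseteq> {..<length ys} \<and>
     (\<forall>i<length xs. R (xs ! i) (ys ! g i)))"

lemma mset_le_mono [mono]:
  "(\<And>x y. R x y \<longrightarrow> S x y) \<Longrightarrow> mset_le R M N \<longrightarrow> mset_le S M N"
  unfolding mset_le_def by metis

text \<open>
  Trees are finite, so the least relation closed under the two clauses is the only one satisfying the
  recursive characterisation.
\<close>

inductive emb :: "tree \<Rightarrow> tree \<Rightarrow> bool"  (infix "\<unlhd>" 50) where
  "m = n \<Longrightarrow> mset_le (\<unlhd>) \<sigma> \<tau> \<Longrightarrow> m \<star> \<sigma> \<unlhd> n \<star> \<tau>"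
| "root s \<le> n \<Longrightarrow> t \<in># \<tau> \<Longrightarrow> s \<unlhd> t \<Longrightarrow> s \<unlhd> n \<star> \<tau>"

fun f :: "rawterm \<Rightarrow> tree" where
  "f Omega = 1 \<star> {#}"
| "f (Theta a) = 0 \<star> {# 1 \<star> {# f a #} #}"
| "f (Seq as) = (if length as = 0 \<or> as ! 0 \<prec> Omega then 0 else 1) \<star> mset (map f as)"

lemma f_in_T2: "f a \<in> T2"
  by (induction a) (auto intro!: T2.intros)

end

theory Submission
  imports Defs "HOL-Combinatorics.Permutations"
begin

text \<open>
  Induction on the sum of the lengths of both terms. The root of \<open>f \<alpha>\<close> is \<open>0\<close> exactly when
  \<open>\<alpha> \<prec> Omega\<close>, and \<open>\<unlhd>\<close> never decreases the root. Hence the node \<open>1 \<star> {# f \<alpha> #}\<close> in the image of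
  \<open>Theta \<alpha>\<close> cannot be matched with a summand of a term below \<open>Omega\<close>, so that an embedding of
  \<open>f (Theta \<alpha>)\<close> into \<open>f \<beta>\<close> factors through \<open>f \<gamma>\<close> for some \<open>\<gamma> \<in> E \<beta>\<close>. Conversely, every \<open>\<gamma> \<in> E \<alpha>\<close>
  has root \<open>0\<close>, so that \<open>f \<gamma> \<unlhd> f \<alpha>\<close>; by transitivity of \<open>\<unlhd>\<close> this yields the side condition on \<open>E\<close>
  when comparing collapsed terms. For sequences, an injection that increases the
  entries of a weakly decreasing sequence can be replaced by the inclusion of indices.
\<close>

section \<open>The order \<open>\<prec>\<close> as a strict partial order\<close>

lemma len_member: "a \<in> set as \<Longrightarrow> len a < len (Seq as)"
  by (metis in_set_conv_nth len_nth)

lemma E_is_Theta: "c \<in> E a \<Longrightarrow> \<exists>d. c = Theta d"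
  by (induction a) auto

lemma Theta_E_less: "c \<in> E a \<Longrightarrow> c \<prec> Theta a"
  using E_is_Theta by fastforce

text \<open>Brings the two ways of being lexicographically smaller into one form:
  \<open>j = length as\<close> is the proper prefix case, where the last premise is vacuous.\<close>

lemma Seq_less_SeqI:
  assumes "j \<le> length as" "j < length bs" "\<And>i. i < j \<Longrightarrow> as ! i = bs ! i"
    and "j < length as \<Longrightarrow> as ! j \<prec> bs ! j"
  shows "Seq as \<prec> Seq bs"
  unfolding prec.simps using assms by (intro exI[of _ j]) (cases "j = length as"; auto)

lemma Seq_less_SeqE:
  assumes "Seq as \<prec> Seq bs"
  obtains j where "j \<le> length as" "j < length bs" "\<forall>i<j. as ! i = bs ! i"
    "j < length as \<longrightarrow> as ! j \<prec> bs ! j"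
proof -
  obtain j where "\<forall>i<j. as ! i = bs ! i"
    "j = length as \<and> length as < length bs \<or> j < min (length as) (length bs) \<and> as ! j \<prec> bs ! j"
    using assms unfolding prec.simps by blast
  then show thesis by (intro that[of j]) auto
qed

lemma Seq_less_Seq_hd:
  assumes "Seq as \<prec> Seq bs" "as \<noteq> []"
  shows "bs \<noteq> []" "as ! 0 \<preceq> bs ! 0"
proof -
  from assms(1) obtain j where "j \<le> length as" "j < length bs" "\<forall>i<j. as ! i = bs ! i"
    "j < length as \<longrightarrow> as ! j \<prec> bs ! j" by (rule Seq_less_SeqE)
  then show "bs \<noteq> []" "as ! 0 \<preceq> bs ! 0" using assms(2) by (cases j; force)+
qed

text \<open>With its dual below, this lets \<open>Omega\<close> and collapsed terms be treated
  together: against a sequence, only the first entry counts.\<close>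

lemma Seq_less_indec: "\<nexists>bs. b = Seq bs \<Longrightarrow> Seq as \<prec> b \<longleftrightarrow> as = [] \<or> as ! 0 \<prec> b"
  by (cases b) auto

lemma indec_less_Seq: "\<nexists>as. a = Seq as \<Longrightarrow> a \<prec> Seq bs \<longleftrightarrow> bs \<noteq> [] \<and> a \<preceq> bs ! 0"
  by (cases a) auto

text \<open>Each unfolding step replaces some of the three terms by shorter ones, but not always the
  same ones; hence the induction on the sum of all three lengths. The cases are split by which of
  the terms are sequences.\<close>

lemma prec_trans: "a \<prec> b \<Longrightarrow> b \<prec> c \<Longrightarrow> a \<prec> c"
proof (induction "len a + len b + len c" arbitrary: a b c rule: less_induct)
  case less
  have IH: "x \<prec> z" if "x \<prec> y" "y \<prec> z" "len x + len y + len z < len a + len b + len c" for x y z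
    using less.hyps that by blast
  have hd: "len (xs ! 0) < len (Seq xs)" if "xs \<noteq> []" for xs
    using that by (intro len_nth) auto
  show ?case
  proof (cases "\<exists>as. a = Seq as")
    case True
    then obtain as where a: "a = Seq as" by blast
    show ?thesis
    proof (cases "\<exists>bs. b = Seq bs")
      case True
      then obtain bs where b: "b = Seq bs" by blast
      show ?thesis
      proof (cases "\<exists>cs. c = Seq cs")
        case True
        then obtain cs where c: "c = Seq cs" by blast
        obtain j where j: "j \<le> length as" "j < length bs" "\<forall>i<j. as ! i = bs ! i"
          "j < length as \<longrightarrow> as ! j \<prec> bs ! j"
          using less.prems(1) unfolding a b by (rule Seq_less_SeqE)
        obtain k where k: "k \<le> length bs" "k < length cs" "\<forall>i<k. bs ! i = cs ! i"
          "k < length bs \<longrightarrow> bs ! k \<prec> cs ! k"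
          using less.prems(2) unfolding b c by (rule Seq_less_SeqE)
        \<comment> \<open>Two lexicographic comparisons compose at the smaller of their positions:
          there one is strict and the other an equality, unless the positions coincide, where the
          induction hypothesis applies.\<close>
        have step: "as ! min j k \<prec> cs ! min j k" if "min j k < length as"
        proof (cases j k rule: linorder_cases)
          case less
          then show ?thesis using that j(4) k(3) by (simp add: min_def)
        next
          case equal
          then have "as ! j \<prec> bs ! j" "bs ! j \<prec> cs ! j" "j < length as" "j < length cs"
            using that j k by auto
          then show ?thesis
            using IH[of "as ! j" "bs ! j" "cs ! j"] equal len_nth[of j as] len_nth[of j bs]
              len_nth[of j cs] j(2) a b c by (simp del: len.simps)
        next
          case greater
          then show ?thesis using that j k by (simp add: min_def)
        qed
        show ?thesis unfolding a c
          by (rule Seq_less_SeqI[of "min j k"]) (use j k step in auto)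
      next
        case False
        show ?thesis
        proof (cases "as = []")
          case False
          then have "bs \<noteq> []" "as ! 0 \<preceq> bs ! 0"
            using Seq_less_Seq_hd less.prems(1) a b by blast+
          moreover have "bs ! 0 \<prec> c"
            using less.prems(2) \<open>bs \<noteq> []\<close> \<open>\<nexists>cs. c = Seq cs\<close> Seq_less_indec b by blast
          ultimately have "as ! 0 \<prec> c"
            using IH[of "as ! 0" "bs ! 0" c] hd[of as] hd[of bs] False a b by (auto simp del: len.simps)
          then show ?thesis using Seq_less_indec \<open>\<nexists>cs. c = Seq cs\<close> a by blast
        qed (use Seq_less_indec \<open>\<nexists>cs. c = Seq cs\<close> a in blast)
      qed
    next
      case b: False
      have as: "as = [] \<or> as ! 0 \<prec> b" using less.prems(1) Seq_less_indec b a by blast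
      show ?thesis
      proof (cases "\<exists>cs. c = Seq cs")
        case True
        then obtain cs where c: "c = Seq cs" by blast
        have cs: "cs \<noteq> []" "b \<preceq> cs ! 0" using less.prems(2) indec_less_Seq b c by blast+
        then have "as ! 0 \<prec> cs ! 0" if "as \<noteq> []"
          using as that IH[of "as ! 0" b "cs ! 0"] hd[of as] hd[of cs] a c by (auto simp del: len.simps)
        then show ?thesis unfolding a c using cs by (intro Seq_less_SeqI[of 0]) auto
      next
        case c: False
        have "as ! 0 \<prec> c" if "as \<noteq> []"
          using as that IH[of "as ! 0" b c] less.prems(2) hd[of as] a by (auto simp del: len.simps)
        then show ?thesis using Seq_less_indec c a by blast
      qed
    qed
  next
    case a: False
    show ?thesis
    proof (cases "\<exists>bs. b = Seq bs")
      case True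
      then obtain bs where b: "b = Seq bs" by blast
      have bs: "bs \<noteq> []" "a \<preceq> bs ! 0" using less.prems(1) indec_less_Seq a b by blast+
      show ?thesis
      proof (cases "\<exists>cs. c = Seq cs")
        case True
        then obtain cs where c: "c = Seq cs" by blast
        have cs: "cs \<noteq> []" "bs ! 0 \<preceq> cs ! 0"
          using Seq_less_Seq_hd less.prems(2) bs(1) b c by blast+
        then have "a \<preceq> cs ! 0"
          using bs IH[of a "bs ! 0" "cs ! 0"] hd[of bs] hd[of cs] b c by (auto simp del: len.simps)
        then show ?thesis using cs indec_less_Seq a c by blast
      next
        case c: False
        then have "bs ! 0 \<prec> c" using less.prems(2) Seq_less_indec b bs(1) by blast
        then show ?thesis
          using bs IH[of a "bs ! 0" c] hd[of bs] b by (auto simp del: len.simps)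
      qed
    next
      case b: False
      show ?thesis
      proof (cases c)
        case (Seq cs)
        then have cs: "cs \<noteq> []" "b \<preceq> cs ! 0" using less.prems(2) indec_less_Seq b by blast+
        then have "a \<preceq> cs ! 0"
          using less.prems(1) IH[of a b "cs ! 0"] hd[of cs] Seq by (auto simp del: len.simps)
        then show ?thesis using cs indec_less_Seq a Seq by blast
      next
        case Omega
        then show ?thesis using less.prems a b by (cases a; cases b) auto
      next
        case (Theta c')
        then obtain b' where b': "b = Theta b'" using less.prems b by (cases b) auto
        then obtain a' where a': "a = Theta a'" using less.prems a by (cases a) auto
        \<comment> \<open>Three collapsed terms. If \<open>b\<close> is bounded by some
          \<open>d \<in> E c'\<close>, so is \<open>a\<close>. Otherwise either \<open>a\<close> is
          bounded by an element of \<open>E b'\<close>, which the side condition puts below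
          \<open>c\<close>, or both comparisons are of the collapsing kind and compose, the side
          condition for \<open>E a'\<close> passing through \<open>b\<close>.\<close>
        consider (below) d where "d \<in> E c'" "b \<preceq> d"
          | (coll) "b' \<prec> c'" "\<forall>d\<in>E b'. d \<prec> c"
          using less.prems(2) Theta b' by auto
        then show ?thesis
        proof cases
          case below
          then have "a \<prec> d"
            using less.prems(1) IH[of a b d] len_E[of d c'] Theta by auto
          then show ?thesis using below a' Theta by auto
        next
          case coll
          consider (below') d where "d \<in> E b'" "a \<preceq> d"
            | (coll') "a' \<prec> b'" "\<forall>d\<in>E a'. d \<prec> b"
            using less.prems(1) b' a' by auto
          then show ?thesis
          proof cases
            case below'
            then have "d \<prec> c" using coll by blast
            then show ?thesis using below' IH[of a d c] len_E[of d b'] b' by auto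
          next
            case coll'
            have "a' \<prec> c'" using IH[of a' b' c'] coll coll' a' b' Theta by auto
            moreover have "d \<prec> c" if "d \<in> E a'" for d
              using IH[of d b c] less.prems(2) that coll' len_E[of d a'] a' by auto
            ultimately show ?thesis using a' Theta by auto
          qed
        qed
      qed
    qed
  qed
qed

text \<open>Transitivity comes first because the collapsing case rests on it:
  \<open>c \<in> E b\<close> lies below \<open>Theta b\<close>, so
  \<open>Theta b \<preceq> c\<close> would give \<open>c \<prec> c\<close> for a term shorter than
  \<open>Theta b\<close>.\<close>

lemma prec_irrefl: "\<not> a \<prec> a"
proof (induction "len a" arbitrary: a rule: less_induct)
  case less
  show ?case
  proof (cases a)
    case (Theta b)
    have "\<not> b \<prec> b" using less Theta by simp
    moreover have "\<not> Theta b \<preceq> c" if "c \<in> E b" for c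
      using that less[of c] len_E[of c b] Theta_E_less[of c b] prec_trans[of c "Theta b" c] Theta
      by auto
    ultimately show ?thesis using Theta by auto
  next
    case (Seq as)
    then show ?thesis using less len_nth by (fastforce simp del: len.simps)
  qed auto
qed

lemma preceq_trans: "a \<preceq> b \<Longrightarrow> b \<preceq> c \<Longrightarrow> a \<preceq> c"
  using prec_trans by blast

text \<open>The one instance of linearity of \<open>\<prec>\<close> that enters the proof; it
  settles the case \<alpha> = \<open>Omega\<close>.\<close>

lemma Omega_preceq_iff: "Omega \<preceq> a \<longleftrightarrow> \<not> a \<prec> Omega"
proof
  assume "Omega \<preceq> a"
  then show "\<not> a \<prec> Omega" using prec_trans prec_irrefl by blast
next
  show "\<not> a \<prec> Omega \<Longrightarrow> Omega \<preceq> a"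
    by (induction a) auto
qed

section \<open>Comparison of weakly decreasing sequences\<close>

lemma hd_less_Seq: "as \<noteq> [] \<Longrightarrow> as ! 0 \<prec> Seq as"
proof (induction "as ! 0" arbitrary: as)
  case (Seq bs)
  \<comment> \<open>The head is itself the sequence \<open>bs\<close>, so position 0 decides: either
    \<open>bs\<close> is empty, or its head lies below \<open>Seq bs\<close> by induction.\<close>
  have "Seq bs \<prec> Seq as"
  proof (rule Seq_less_SeqI[of 0])
    assume "0 < length bs"
    then have "bs ! 0 \<prec> Seq bs" by (intro Seq.hyps(1)) auto
    then show "bs ! 0 \<prec> as ! 0" using Seq.hyps(2) by simp
  qed (use Seq.prems in auto)
  then show ?case using Seq.hyps(2) by simp
qed (use indec_less_Seq in \<open>metis rawterm.distinct\<close>)+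

lemma theta_terms_nth_mono:
  assumes "Seq as \<in> theta_terms" "i \<le> j" "j < length as"
  shows "as ! j \<preceq> as ! i"
  using assms(2,3)
proof (induction j rule: dec_induct)
  case (step n)
  have "as ! Suc n \<preceq> as ! n"
    using assms(1) step.prems by (cases rule: theta_terms.cases) auto
  then show ?case using step preceq_trans by (meson Suc_lessD)
qed simp

text \<open>At the first position where the entries differ the comparison is strict; if there is
  none, \<open>as\<close> is a prefix of \<open>bs\<close>.\<close>

lemma pointwise_preceq_imp_Seq_preceq:
  assumes "length as \<le> length bs" "\<And>i. i < length as \<Longrightarrow> as ! i \<preceq> bs ! i"
  shows "Seq as \<preceq> Seq bs"
proof (cases "\<exists>i<length as. as ! i \<noteq> bs ! i")
  case True
  define j where "j = (LEAST i. i < length as \<and> as ! i \<noteq> bs ! i)"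
  have j: "j < length as" "as ! j \<noteq> bs ! j"
    unfolding j_def using LeastI_ex[OF True] by auto
  have "as ! i = bs ! i" if "i < j" for i
    using not_less_Least[of i "\<lambda>i. i < length as \<and> as ! i \<noteq> bs ! i"] that j(1) by (auto simp: j_def)
  then have "Seq as \<prec> Seq bs"
    using j assms by (intro Seq_less_SeqI[of j]) auto
  then show ?thesis ..
next
  case False
  show ?thesis
  proof (cases "length as = length bs")
    case True
    then show ?thesis using False by (simp add: nth_equalityI)
  next
    case neq: False
    then have "Seq as \<prec> Seq bs"
      using False assms by (intro Seq_less_SeqI[of "length as"]) auto
    then show ?thesis ..
  qed
qed

lemma injection_imp_Seq_preceq:
  assumes as: "Seq as \<in> theta_terms" and bs: "Seq bs \<in> theta_terms"
    and g: "inj_on g {..<length as}" "g ` {..<length as} \<subseteq> {..<length bs}"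
    and le: "\<And>i. i < length as \<Longrightarrow> as ! i \<preceq> bs ! g i"
  shows "Seq as \<preceq> Seq bs"
proof (rule pointwise_preceq_imp_Seq_preceq)
  show "length as \<le> length bs" using card_inj_on_le[OF g] by simp
next
  fix i assume i: "i < length as"
  \<comment> \<open>By the pigeonhole principle the first \<open>Suc i\<close> indices are not all sent below \<open>i\<close>.\<close>
  have "inj_on g {..i}" using g(1) i by (auto intro: inj_on_subset)
  then have "\<not> g ` {..i} \<subseteq> {..<i}" using card_inj_on_le[of g "{..i}" "{..<i}"] by auto
  then obtain k where k: "k \<le> i" "i \<le> g k" by force
  then have "as ! i \<preceq> as ! k" using theta_terms_nth_mono[OF as] i by blast
  moreover have "as ! k \<preceq> bs ! g k" using le k i by auto
  moreover have "bs ! g k \<preceq> bs ! i" 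
  proof (rule theta_terms_nth_mono[OF bs k(2)])
    have "k < length as" using k(1) i by simp
    then show "g k < length bs" using g(2) by auto
  qed
  ultimately show "as ! i \<preceq> bs ! i" using preceq_trans by blast
qed

section \<open>The multiset extension of a relation\<close>

lemma mset_le_mset_iff:
  "mset_le R (mset xs) (mset ys) \<longleftrightarrow>
    (\<exists>g. inj_on g {..<length xs} \<and> g ` {..<length xs} \<subseteq> {..<length ys} \<and>
      (\<forall>i<length xs. R (xs ! i) (ys ! g i)))"
  (is "?L \<longleftrightarrow> ?R")
proof
  assume ?L
  then obtain xs' ys' g where *: "mset xs = mset xs'" "mset ys = mset ys'"
    "inj_on g {..<length xs'}" "g ` {..<length xs'} \<subseteq> {..<length ys'}"
    "\<And>i. i < length xs' \<Longrightarrow> R (xs' ! i) (ys' ! g i)"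
    unfolding mset_le_def by blast
  \<comment> \<open>\<open>mset_le\<close> only provides some listings of the two multisets.
    \<open>p\<close> takes positions in \<open>xs\<close> to positions in \<open>xs'\<close>, and
    \<open>q\<close> takes those in \<open>ys'\<close> to those in \<open>ys\<close>, so
    \<open>q \<circ> g \<circ> p\<close> is the injection for the given lists.\<close>
  obtain p where p: "p permutes {..<length xs'}" "permute_list p xs' = xs"
    using mset_eq_permutation[OF *(1)] by blast
  obtain q where q: "q permutes {..<length ys}" "permute_list q ys = ys'"
    using mset_eq_permutation[OF *(2)[symmetric]] by blast
  have len: "length xs' = length xs" "length ys' = length ys"
    using *(1,2) mset_eq_length by metis+
  have p_in: "p i < length xs" if "i < length xs" for i
    using permutes_in_image[OF p(1), of i] that len by simp
  have g_in: "g i < length ys" if "i < length xs" for i using *(4) that len by auto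
  have "inj_on (q \<circ> g \<circ> p) {..<length xs}"
    using *(3) p_in permutes_inj[OF p(1)] permutes_inj[OF q(1)] len
    by (intro comp_inj_on inj_on_subset[OF *(3)] inj_on_subset[OF permutes_inj[OF p(1)]]
        inj_on_subset[OF permutes_inj[OF q(1)]]) auto
  moreover have "(q \<circ> g \<circ> p) ` {..<length xs} \<subseteq> {..<length ys}"
    using p_in g_in permutes_in_image[OF q(1)] by auto
  moreover have "R (xs ! i) (ys ! (q \<circ> g \<circ> p) i)" if "i < length xs" for i
    using *(5)[of "p i"] that p_in[of i] g_in[of "p i"] len
      permute_list_nth[OF p(1), of i] permute_list_nth[OF q(1), of "g (p i)"] p(2) q(2) by simp
  ultimately show ?R by blast
next
  assume ?R
  then show ?L unfolding mset_le_def by blast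
qed

lemma mset_le_refl: "(\<And>x. x \<in># M \<Longrightarrow> R x x) \<Longrightarrow> mset_le R M M"
proof -
  assume R: "\<And>x. x \<in># M \<Longrightarrow> R x x"
  obtain xs where "M = mset xs" by (metis ex_mset)
  then show ?thesis using R by (auto simp: mset_le_mset_iff intro!: exI[of _ id])
qed

text \<open>The three relations are kept apart because, when transitivity of \<open>\<unlhd>\<close>
  is proved, the second one also carries the induction hypothesis.\<close>

lemma mset_le_trans:
  assumes "mset_le R M N" "mset_le S N K" "\<And>x y z. R x y \<Longrightarrow> S y z \<Longrightarrow> Q x z"
  shows "mset_le Q M K"
proof -
  obtain xs ys zs where [simp]: "M = mset xs" "N = mset ys" "K = mset zs" by (metis ex_mset)
  obtain g where g: "inj_on g {..<length xs}" "g ` {..<length xs} \<subseteq> {..<length ys}"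
      "\<forall>i<length xs. R (xs ! i) (ys ! g i)"
    using assms(1) by (auto simp: mset_le_mset_iff)
  obtain h where h: "inj_on h {..<length ys}" "h ` {..<length ys} \<subseteq> {..<length zs}"
      "\<forall>i<length ys. S (ys ! i) (zs ! h i)"
    using assms(2) by (auto simp: mset_le_mset_iff)
  have "inj_on (h \<circ> g) {..<length xs}" using g(1,2) h(1) by (blast intro: comp_inj_on inj_on_subset)
  moreover have "(h \<circ> g) ` {..<length xs} \<subseteq> {..<length zs}" using g(2) h(2) by fastforce
  moreover have "\<forall>i<length xs. Q (xs ! i) (zs ! (h \<circ> g) i)"
    using g(2,3) h(3) assms(3) by (auto simp: image_subset_iff)
  ultimately show ?thesis by (auto simp: mset_le_mset_iff intro!: exI[of _ "h \<circ> g"])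
qed

lemma mset_le_member:
  assumes "mset_le R M N" "x \<in># M"
  shows "\<exists>y\<in>#N. R x y"
proof -
  obtain xs ys where [simp]: "M = mset xs" "N = mset ys" by (metis ex_mset)
  obtain g where g: "g ` {..<length xs} \<subseteq> {..<length ys}" "\<forall>i<length xs. R (xs ! i) (ys ! g i)"
    using assms(1) by (auto simp: mset_le_mset_iff)
  obtain i where "i < length xs" "x = xs ! i" using assms(2) by (auto simp: in_set_conv_nth)
  then show ?thesis using g by (intro bexI[of _ "ys ! g i"]) auto
qed

lemma mset_le_size: "mset_le R M N \<Longrightarrow> size M \<le> size N"
proof -
  assume "mset_le R M N"
  then obtain xs ys g where "M = mset xs" "N = mset ys" "inj_on g {..<length xs}"
    "g ` {..<length xs} \<subseteq> {..<length ys}"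
    unfolding mset_le_def by blast
  then show ?thesis using card_inj_on_le[of g "{..<length xs}" "{..<length ys}"] by simp
qed

section \<open>The embedding of trees as a preorder\<close>

lemma emb_Star_iff:
  "s \<unlhd> n \<star> \<tau> \<longleftrightarrow>
    (\<exists>\<sigma>. s = n \<star> \<sigma> \<and> mset_le (\<unlhd>) \<sigma> \<tau>) \<or> (root s \<le> n \<and> (\<exists>t\<in>#\<tau>. s \<unlhd> t))"
  by (subst emb.simps) auto

lemma emb_root: "s \<unlhd> t \<Longrightarrow> root s \<le> root t"
  by (cases t) (auto simp: emb_Star_iff)

lemma emb_refl: "s \<unlhd> s"
  by (induction s) (auto simp: emb_Star_iff intro: mset_le_refl)

text \<open>The rule induction runs over the upper embedding, which is therefore the first premise.
  If it matches roots, the lower one is inverted: matchings of children compose, and an embedding of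
  \<open>s\<close> into a child of \<open>t\<close> continues into a child of
  \<open>u\<close>.\<close>

lemma emb_trans:
  assumes "t \<unlhd> u" "s \<unlhd> t"
  shows "s \<unlhd> u"
  using assms
proof (induction arbitrary: s)
  case (1 m n \<sigma> \<tau>)
  from "1.prems" consider \<rho> where "s = m \<star> \<rho>" "mset_le (\<unlhd>) \<rho> \<sigma>"
    | x where "root s \<le> m" "x \<in># \<sigma>" "s \<unlhd> x"
    unfolding emb_Star_iff by blast
  then show ?case
  proof cases
    case 1
    then show ?thesis
      \<comment> \<open>The underscore stands for \<open>\<unlhd>\<close> conjoined with the
        induction hypothesis.\<close>
      using mset_le_trans[OF 1(2) \<open>mset_le _ \<sigma> \<tau>\<close>, of "(\<unlhd>)"] \<open>m = n\<close> by (auto simp: emb_Star_iff)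
  next
    case 2
    then show ?thesis
      using mset_le_member[OF \<open>mset_le _ \<sigma> \<tau>\<close> 2(2)] \<open>m = n\<close> by (auto simp: emb_Star_iff)
  qed
next
  case (2 t n u \<tau>)
  then show ?case using emb_root[OF "2.prems"] by (auto simp: emb_Star_iff)
qed

section \<open>Embeddings between the images of terms under \<open>f\<close>\<close>

lemma root_f: "root (f a) = (if a \<prec> Omega then 0 else 1)"
  by (cases a) auto

text \<open>The root condition holds because the entries decrease: if the head is below
  \<open>Omega\<close>, every entry is, so a sequence with root 0 has only entries with root
  0.\<close>

lemma emb_f_member:
  assumes "a \<in> set as" "Seq as \<in> theta_terms"
  shows "f a \<unlhd> f (Seq as)"
proof -
  obtain i where i: "i < length as" "a = as ! i" using assms(1) by (auto simp: in_set_conv_nth)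
  then have "a \<preceq> as ! 0" using theta_terms_nth_mono[OF assms(2), of 0 i] by auto
  then have "as ! 0 \<prec> Omega \<Longrightarrow> a \<prec> Omega" using prec_trans by blast
  then have "root (f a) \<le> root (f (Seq as))" using i by (auto simp: root_f)
  then show ?thesis
    using assms(1) emb_refl[of "f a"] by (fastforce simp: emb_Star_iff)
qed

text \<open>Between \<open>c\<close> and \<open>a\<close> there are only sequence nodes, since
  \<open>E\<close> stops at collapsed terms, and a tree with root 0 may pass below any of
  them.\<close>

lemma E_emb: "c \<in> E a \<Longrightarrow> f c \<unlhd> f a"
proof (induction a)
  case (Seq as)
  then obtain a where a: "a \<in> set as" "f c \<unlhd> f a" by auto
  moreover have "root (f c) = 0" using E_is_Theta[OF Seq.prems] by auto
  ultimately show ?case by (auto simp: emb_Star_iff)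
qed (auto intro: emb_refl)

lemma emb_f_Theta:
  assumes "s \<unlhd> f b" "root s = 0"
  shows "s \<unlhd> f (Theta b)"
  using assms by (auto simp: emb_Star_iff)

lemma Theta_emb_Seq:
  assumes "f (Theta a) \<unlhd> f (Seq bs)" "Seq bs \<in> theta_terms"
  shows "\<exists>b\<in>set bs. f (Theta a) \<unlhd> f b"
proof (rule ccontr)
  assume neg: "\<not> ?thesis"
  \<comment> \<open>With no embedding into a summand, the roots must be matched. So
    \<open>f (Seq bs)\<close> has root 0, and \<open>1 \<star> {#f a#}\<close> embeds into the image
    of some summand.\<close>
  then have bs: "bs = [] \<or> bs ! 0 \<prec> Omega" "mset_le (\<unlhd>) {#1 \<star> {#f a#}#} (mset (map f bs))"
    using assms(1) by (auto simp: emb_Star_iff split: if_splits)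
  then obtain b where b: "b \<in> set bs" "1 \<star> {#f a#} \<unlhd> f b"
    using mset_le_member[OF bs(2), of "1 \<star> {#f a#}"] by auto
  then obtain i where "i < length bs" "b = bs ! i" by (auto simp: in_set_conv_nth)
  then have "b \<prec> Omega"
    using theta_terms_nth_mono[OF assms(2), of 0 i] bs(1) prec_trans[of b "bs ! 0" Omega] by auto
  then show False using emb_root[OF b(2)] by (simp add: root_f)
qed

lemma theta_terms_member: "Seq as \<in> theta_terms \<Longrightarrow> a \<in> set as \<Longrightarrow> a \<in> theta_terms"
  by (cases rule: theta_terms.cases) auto

lemma theta_terms_ThetaD: "Theta a \<in> theta_terms \<Longrightarrow> a \<in> theta_terms"
  by (cases rule: theta_terms.cases) auto

lemma theta_terms_E: "a \<in> theta_terms \<Longrightarrow> c \<in> E a \<Longrightarrow> c \<in> theta_terms"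
  by (induction rule: theta_terms.induct) (auto intro: theta_terms.Theta)

text \<open>Descend through nested sequences until a collapsed term is reached; \<open>Omega\<close>
  is excluded, as its image is a single node labelled 1.\<close>

lemma Theta_emb_E:
  "b \<in> theta_terms \<Longrightarrow> f (Theta a) \<unlhd> f b \<Longrightarrow> \<exists>c\<in>E b. f (Theta a) \<unlhd> f c"
proof (induction b)
  case Omega
  then show ?case by (auto simp: emb_Star_iff)
next
  case (Seq bs)
  then obtain b where "b \<in> set bs" "f (Theta a) \<unlhd> f b" using Theta_emb_Seq by blast
  then show ?case using Seq theta_terms_member by fastforce
qed auto

text \<open>Below the root of \<open>f (Theta b)\<close> sits a node labelled 1. A tree with root 0
  cannot be matched with that node and must go on into \<open>f b\<close>.\<close>

lemma emb_f_Theta_cases: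
  assumes "f a \<unlhd> f (Theta b)"
  obtains (inner) "f a \<unlhd> f b"
    | (outer) \<sigma> where "f a = 0 \<star> \<sigma>" "mset_le (\<unlhd>) \<sigma> {#1 \<star> {#f b#}#}"
proof -
  have "f a \<unlhd> f b" if "root (f a) \<le> 0" "f a \<unlhd> 1 \<star> {#f b#}"
    using that by (auto simp: emb_Star_iff)
  then show thesis using assms that by (auto simp: emb_Star_iff)
qed

theorem theorem3p6:
  fixes \<alpha> \<beta> :: rawterm
  assumes "\<alpha> \<in> theta_terms" and "\<beta> \<in> theta_terms"
    and "f \<alpha> \<unlhd> f \<beta>"
  shows "\<alpha> \<preceq> \<beta>"
  using assms
proof (induction "len \<alpha> + len \<beta>" arbitrary: \<alpha> \<beta> rule: less_induct)
  case less
  note wf = less.prems(1,2)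
  have IH: "x \<preceq> y" if "x \<in> theta_terms" "y \<in> theta_terms" "f x \<unlhd> f y"
    "len x + len y < len \<alpha> + len \<beta>" for x y
    using less.hyps that by blast
  \<comment> \<open>This later excludes equality with \<beta> where the induction hypothesis gives
    only \<open>\<preceq>\<close>. Here \<beta> = \<open>Theta b\<close> takes the first place in
    the induction hypothesis, and its length has to be below that of \<alpha> for the sum to
    decrease.\<close>
  have not_emb: "\<not> f (Theta b) \<unlhd> f b" if *: "Theta b \<in> theta_terms" "len (Theta b) < len \<alpha>"
    "\<beta> = Theta b" for b
  proof
    assume "f (Theta b) \<unlhd> f b"
    then obtain c where c: "c \<in> E b" "f (Theta b) \<unlhd> f c"
      using Theta_emb_E theta_terms_ThetaD *(1) by blast
    then have "Theta b \<preceq> c"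
    proof (intro IH)
      show "c \<in> theta_terms" using c(1) *(1) theta_terms_E theta_terms_ThetaD by blast
      show "len (Theta b) + len c < len \<alpha> + len \<beta>" using * len_E[OF c(1)] by simp
    qed (use * in simp)
    then show False using Theta_E_less[OF c(1)] prec_trans prec_irrefl by blast
  qed
  show ?case
  proof (cases \<alpha>)
    case Omega
    then have "\<not> \<beta> \<prec> Omega" using emb_root[OF less.prems(3)] by (auto simp: root_f split: if_splits)
    then show ?thesis using Omega Omega_preceq_iff by blast
  next
    case \<alpha>: (Theta a)
    show ?thesis
    proof (cases \<beta>)
      case Omega
      then show ?thesis using \<alpha> by simp
    next
      case \<beta>: (Seq bs)
      obtain b where b: "b \<in> set bs" "f \<alpha> \<unlhd> f b"
        using Theta_emb_Seq less.prems \<alpha> \<beta> by blast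
      then obtain i where i: "i < length bs" "b = bs ! i" by (auto simp: in_set_conv_nth)
      have "\<alpha> \<preceq> b"
        using IH[OF wf(1) _ b(2)] wf(2) \<beta> theta_terms_member[OF _ b(1)] len_member[OF b(1)]
        by (simp del: len.simps)
      moreover have "b \<preceq> bs ! 0" using theta_terms_nth_mono wf(2) \<beta> i by blast
      ultimately have "\<alpha> \<preceq> bs ! 0" using preceq_trans by blast
      then show ?thesis using \<alpha> \<beta> i by auto
    next
      case \<beta>: (Theta b)
      have a: "a \<in> theta_terms" and b: "b \<in> theta_terms"
        using theta_terms_ThetaD wf \<alpha> \<beta> by blast+
      from less.prems(3)[unfolded \<beta>] show ?thesis
      proof (cases rule: emb_f_Theta_cases)
        case inner
        then obtain c where c: "c \<in> E b" "f \<alpha> \<unlhd> f c" using Theta_emb_E b \<alpha> by blast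
        then have "\<alpha> \<preceq> c" 
          using IH[OF wf(1) theta_terms_E[OF b c(1)] c(2)] len_E[OF c(1)] \<beta> by simp
        then show ?thesis using \<alpha> \<beta> c(1) by auto
      next
        case (outer \<sigma>)
        then have "1 \<star> {#f a#} \<unlhd> 1 \<star> {#f b#}"
          using mset_le_member[OF outer(2), of "1 \<star> {#f a#}"] \<alpha> by auto
        then have "f a \<unlhd> f b"
        proof (subst (asm) emb_Star_iff, elim disjE conjE exE)
          fix \<sigma> assume "1 \<star> {#f a#} = 1 \<star> \<sigma>" "mset_le (\<unlhd>) \<sigma> {#f b#}"
          then show ?thesis using mset_le_member[of "(\<unlhd>)" \<sigma> "{#f b#}" "f a"] by auto
        next
          assume "\<exists>t\<in>#{#f b#}. 1 \<star> {#f a#} \<unlhd> t"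
          then have "1 \<star> {#f a#} \<unlhd> f b" by simp
          \<comment> \<open>Even if \<open>1 \<star> {#f a#}\<close> disappears into
            \<open>f b\<close> as a whole, it takes \<open>f a\<close> along: label 1 bounds every
            root of an image.\<close>
          moreover have "f a \<unlhd> 1 \<star> {#f a#}" by (auto simp: emb_Star_iff root_f emb_refl)
          ultimately show ?thesis by (rule emb_trans)
        qed
        then have "a \<preceq> b" using IH a b \<alpha> \<beta> by simp
        \<comment> \<open>The side condition on \<open>E a\<close>. Equality
          \<open>c = \<beta>\<close> would turn \<open>f c \<unlhd> f b\<close> into the embedding
          excluded by \<open>not_emb\<close>.\<close>
        moreover have "c \<prec> \<beta>" if c: "c \<in> E a" for c
        proof -
          have "root (f c) = 0" using E_is_Theta[OF c] by auto
          moreover have "f c \<unlhd> f b" using emb_trans \<open>f a \<unlhd> f b\<close> E_emb[OF c] by blast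
          ultimately have "f c \<unlhd> f \<beta>" using emb_f_Theta \<beta> by blast
          then have "c \<preceq> \<beta>" using IH[of c \<beta>] theta_terms_E[OF a c] wf(2) len_E[OF c] \<alpha> by simp
          moreover have "c \<noteq> \<beta>"
            using not_emb[of b] \<open>f c \<unlhd> f b\<close> wf(2) len_E[OF c] \<alpha> \<beta> by auto
          ultimately show ?thesis by blast
        qed
        ultimately show ?thesis using \<alpha> \<beta> by auto
      qed
    qed
  next
    case \<alpha>: (Seq as)
    show ?thesis
    proof (cases \<beta>)
      case Omega
      then show ?thesis
        \<comment> \<open>An impossible case: \<open>f Omega\<close> has no children, so
          \<open>as\<close> would be empty, but then the root of \<open>f \<alpha>\<close> is 0
          instead of 1.\<close>
        using less.prems(3) \<alpha> mset_le_size by (fastforce simp: emb_Star_iff split: if_splits)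
    next
      case \<beta>: (Seq bs)
      from less.prems(3) consider
          "mset_le (\<unlhd>) (mset (map f as)) (mset (map f bs))"
        | b where "b \<in> set bs" "f \<alpha> \<unlhd> f b"
        unfolding \<alpha> \<beta> by (subst (asm) (3) f.simps, subst (asm) emb_Star_iff) auto
      then show ?thesis
      proof cases
        case 1
        then obtain g where g: "inj_on g {..<length as}" "g ` {..<length as} \<subseteq> {..<length bs}"
          "\<And>i. i < length as \<Longrightarrow> map f as ! i \<unlhd> map f bs ! g i"
          unfolding mset_le_mset_iff by auto
        have "as ! i \<preceq> bs ! g i" if i: "i < length as" for i
        proof -
          have j: "g i < length bs" using g(2) i by auto
          have "f (as ! i) \<unlhd> f (bs ! g i)" using g(3)[OF i] i j by simp
          then show ?thesis
            using IH[of "as ! i" "bs ! g i"] wf theta_terms_member \<alpha> \<beta> i j nth_mem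
              add_strict_mono[OF len_nth[OF i] len_nth[OF j]] by (metis (no_types))
        qed
        then show ?thesis using injection_imp_Seq_preceq[OF _ _ g(1,2)] wf \<alpha> \<beta> by blast
      next
        case 2
        then obtain i where i: "i < length bs" "b = bs ! i" by (auto simp: in_set_conv_nth)
        have "\<alpha> \<preceq> b"
          using IH[OF wf(1) _ 2(2)] wf(2) \<beta> theta_terms_member[OF _ 2(1)] len_member[OF 2(1)]
          by (simp del: len.simps)
        moreover have "b \<preceq> bs ! 0" using theta_terms_nth_mono wf(2) \<beta> i by blast
        moreover have "bs ! 0 \<preceq> \<beta>" using hd_less_Seq[of bs] \<beta> i by force
        ultimately show ?thesis using preceq_trans by blast
      qed
    next
      case \<beta>: (Theta b)
      have b: "b \<in> theta_terms" using theta_terms_ThetaD wf \<beta> by blast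
      have "as ! 0 \<prec> \<beta>" if "as \<noteq> []"
      proof -
        define a where "a = as ! 0"
        have mem: "a \<in> set as" using that by (simp add: a_def)
        then have a: "a \<in> theta_terms" "len a < len \<alpha>"
          using theta_terms_member wf len_member \<alpha> by blast+
        have "root (f \<alpha>) = 0" using emb_root[OF less.prems(3)] \<beta> by simp
        then have root: "root (f a) = 0" using that \<alpha> by (simp add: a_def root_f split: if_splits)
        \<comment> \<open>The goal is strict, so besides an embedding into \<open>f b\<close>, and
          hence into \<open>f \<beta>\<close>, the equality \<open>a = \<beta>\<close> has to be
          ruled out.\<close>
        have to_b: "f a \<unlhd> f b \<and> (a \<noteq> \<beta>)"
          using less.prems(3)[unfolded \<beta>]
        proof (cases rule: emb_f_Theta_cases)
          case inner
          then have "f a \<unlhd> f b" using emb_trans emb_f_member mem wf \<alpha> by blast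
          then show ?thesis using not_emb[of b] wf(2) a(2) \<beta> by auto
        next
          case (outer \<sigma>)
          then have \<sigma>: "\<sigma> = mset (map f as)" using \<alpha> by simp
          then have "f a \<in># \<sigma>" using mem by simp
          then have "f a \<unlhd> 1 \<star> {#f b#}" using mset_le_member[OF outer(2)] by simp
          then have "f a \<unlhd> f b" using root by (auto simp: emb_Star_iff)
          \<comment> \<open>The root of \<open>f \<beta>\<close> has just one child, so
            \<open>as\<close> is a singleton, and well-formedness forbids its entry to be a
            collapsed term.\<close>
          have "length as = 1" using mset_le_size[OF outer(2)] \<sigma> that by (cases as) auto
          with wf(1)[unfolded \<alpha>] have "a \<noteq> Theta b"
            by (cases rule: theta_terms.cases) (auto simp: a_def)
          then show ?thesis using \<open>f a \<unlhd> f b\<close> \<beta> by blast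
        qed
        then have "f a \<unlhd> f \<beta>" using emb_f_Theta root \<beta> by blast
        then show ?thesis using IH[of a \<beta>] a wf(2) to_b by (auto simp: a_def)
      qed
      then show ?thesis using \<alpha> \<beta> by auto
    qed
  qed
qed

end
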